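(* The variety $\mathbb{DP}$ is generated by any set of DP-chains of unbounded cardinality (i.e. any set $S$ of DP-chains such that for every natural number $n$ some member of $S$ has more than $n$ elements).
   Context: MTL-algebras are bounded, commutative, integral, prelinear residuated lattices $(A,*,\Rightarrow,\sqcap,\sqcup,0,1)$. A DP-chain (drastic product chain) is a totally ordered MTL-algebra in which $x*y=0$ whenever $x,y<1$ and $x*y=\min\{x,y\}$ otherwise; $\mathbb{DP}$ is the variety of MTL-algebras generated by all DP-chains. *)

theory Defs
  imports "HOL-Algebra.Group" "HOL-Library.Infinite_Typeclass"
begin

record 'a mtl = "'a monoid" +
  imp :: "'a \<Rightarrow> 'a \<Rightarrow> 'a"
  lmeet :: "'a \<Rightarrow> 'a \<Rightarrow> 'a"
  ljoin :: "'a \<Rightarrow> 'a \<Rightarrow> 'a"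
  bottom :: 'a

definition mtl_le :: "'a mtl \<Rightarrow> 'a \<Rightarrow> 'a \<Rightarrow> bool" where
  "mtl_le A x y \<longleftrightarrow> lmeet A x y = x"

definition mtl_less :: "'a mtl \<Rightarrow> 'a \<Rightarrow> 'a \<Rightarrow> bool" where
  "mtl_less A x y \<longleftrightarrow> mtl_le A x y \<and> x \<noteq> y"

text \<open>Integrality means that the monoid unit is the greatest element, so a single
  constant serves for both.\<close>

locale mtl_algebra = comm_monoid A for A :: "'a mtl" (structure) +
  assumes imp_closed: "\<lbrakk>x \<in> carrier A; y \<in> carrier A\<rbrakk> \<Longrightarrow> imp A x y \<in> carrier A"
    and meet_closed: "\<lbrakk>x \<in> carrier A; y \<in> carrier A\<rbrakk> \<Longrightarrow> lmeet A x y \<in> carrier A"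
    and join_closed: "\<lbrakk>x \<in> carrier A; y \<in> carrier A\<rbrakk> \<Longrightarrow> ljoin A x y \<in> carrier A"
    and bottom_closed: "bottom A \<in> carrier A"
    and meet_commute: "\<lbrakk>x \<in> carrier A; y \<in> carrier A\<rbrakk> \<Longrightarrow> lmeet A x y = lmeet A y x"
    and join_commute: "\<lbrakk>x \<in> carrier A; y \<in> carrier A\<rbrakk> \<Longrightarrow> ljoin A x y = ljoin A y x"
    and meet_assoc: "\<lbrakk>x \<in> carrier A; y \<in> carrier A; z \<in> carrier A\<rbrakk>
      \<Longrightarrow> lmeet A (lmeet A x y) z = lmeet A x (lmeet A y z)"
    and join_assoc: "\<lbrakk>x \<in> carrier A; y \<in> carrier A; z \<in> carrier A\<rbrakk>
      \<Longrightarrow> ljoin A (ljoin A x y) z = ljoin A x (ljoin A y z)"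
    and meet_join_absorb: "\<lbrakk>x \<in> carrier A; y \<in> carrier A\<rbrakk> \<Longrightarrow> lmeet A x (ljoin A x y) = x"
    and join_meet_absorb: "\<lbrakk>x \<in> carrier A; y \<in> carrier A\<rbrakk> \<Longrightarrow> ljoin A x (lmeet A x y) = x"
    and bottom_least: "x \<in> carrier A \<Longrightarrow> mtl_le A (bottom A) x"
    and one_greatest: "x \<in> carrier A \<Longrightarrow> mtl_le A x \<one>"
    and residuation: "\<lbrakk>x \<in> carrier A; y \<in> carrier A; z \<in> carrier A\<rbrakk>
      \<Longrightarrow> mtl_le A (x \<otimes> z) y \<longleftrightarrow> mtl_le A z (imp A x y)"
    and prelinearity: "\<lbrakk>x \<in> carrier A; y \<in> carrier A\<rbrakk>
      \<Longrightarrow> ljoin A (imp A x y) (imp A y x) = \<one>"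

locale DP_chain = mtl_algebra +
  assumes total: "\<lbrakk>x \<in> carrier A; y \<in> carrier A\<rbrakk> \<Longrightarrow> mtl_le A x y \<or> mtl_le A y x"
    and drastic_product: "\<lbrakk>x \<in> carrier A; y \<in> carrier A\<rbrakk>
      \<Longrightarrow> x \<otimes> y = (if mtl_less A x \<one> \<and> mtl_less A y \<one> then bottom A
                   else if mtl_le A x y then x else y)"

datatype mtl_term =
    Var nat
  | Bot
  | Top
  | Times mtl_term mtl_term
  | Imp mtl_term mtl_term
  | Meet mtl_term mtl_term
  | Join mtl_term mtl_term

primrec eval_term :: "'a mtl \<Rightarrow> (nat \<Rightarrow> 'a) \<Rightarrow> mtl_term \<Rightarrow> 'a" where
  "eval_term A v (Var i) = v i"
| "eval_term A v Bot = bottom A"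
| "eval_term A v Top = \<one>\<^bsub>A\<^esub>"
| "eval_term A v (Times s t) = eval_term A v s \<otimes>\<^bsub>A\<^esub> eval_term A v t"
| "eval_term A v (Imp s t) = imp A (eval_term A v s) (eval_term A v t)"
| "eval_term A v (Meet s t) = lmeet A (eval_term A v s) (eval_term A v t)"
| "eval_term A v (Join s t) = ljoin A (eval_term A v s) (eval_term A v t)"

definition satisfies :: "'a mtl \<Rightarrow> mtl_term \<times> mtl_term \<Rightarrow> bool" where
  "satisfies A e \<longleftrightarrow>
    (\<forall>v. (\<forall>i. v i \<in> carrier A) \<longrightarrow> eval_term A v (fst e) = eval_term A v (snd e))"

text \<open>The variety of MTL-algebras axiomatized by a set \<open>E\<close> of identities. Since \<open>E\<close> does not
  mention the carrier type, it determines a class of algebras over every type.\<close>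

definition variety :: "(mtl_term \<times> mtl_term) set \<Rightarrow> 'a mtl set" where
  "variety E = {A. mtl_algebra A \<and> (\<forall>e\<in>E. satisfies A e)}"

text \<open>The least variety containing \<open>K\<close>: the intersection of all varieties that contain \<open>K\<close>. The
  members of \<open>K\<close> and those of the generated variety may have carriers in different types.\<close>

definition generated_variety :: "'a mtl set \<Rightarrow> 'c mtl set" where
  "generated_variety K = \<Inter> {variety E | E. K \<subseteq> variety E}"

text \<open>The class of all DP-chains is represented by those with carrier in a universe type \<open>'u\<close>,
  which is infinite because a finite one would only contain chains of bounded size.\<close>

definition DP :: "'u::infinite itself \<Rightarrow> 'c mtl set" where
  "DP _ = generated_variety {A :: 'u mtl. DP_chain A}"

end

theory Submission
  imports Defs
begin

text \<open>In a DP-chain every operation is determined by the order together with the constants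
  \<open>0\<close>, \<open>1\<close> and the coatom \<open>c\<close>: if \<open>y < x < 1\<close> then \<open>x \<Rightarrow> y = c\<close>. So adding \<open>0\<close>, \<open>c\<close>, \<open>1\<close> to
  the finitely many values of the variables of an identity gives a finite subalgebra, and this
  subalgebra embeds into every sufficiently large DP-chain, because a bijection of finite chains
  that preserves the order also preserves the bounds and the coatom. An identity refuted in some
  DP-chain is thus refuted in every sufficiently large one; hence all families of DP-chains of
  unbounded size satisfy the same identities.\<close>

section \<open>Order, lattice operations and residuum in MTL-algebras\<close>

context mtl_algebra
begin

text \<open>Both absorption laws combine: \<open>x\<close> is its own join with
  \<open>lmeet A x x\<close>, and the meet of \<open>x\<close> with that join is
  \<open>x\<close>.\<close>

lemma meet_idem: "x \<in> carrier A \<Longrightarrow> lmeet A x x = x"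
  by (metis join_meet_absorb meet_closed meet_join_absorb)

lemma le_refl: "x \<in> carrier A \<Longrightarrow> mtl_le A x x"
  by (simp add: mtl_le_def meet_idem)

lemma le_antisym:
  "\<lbrakk>x \<in> carrier A; y \<in> carrier A; mtl_le A x y; mtl_le A y x\<rbrakk> \<Longrightarrow> x = y"
  by (metis mtl_le_def meet_commute)

lemma le_trans:
  "\<lbrakk>x \<in> carrier A; y \<in> carrier A; z \<in> carrier A; mtl_le A x y; mtl_le A y z\<rbrakk> \<Longrightarrow> mtl_le A x z"
  by (metis mtl_le_def meet_assoc)

lemma less_trans:
  "\<lbrakk>x \<in> carrier A; y \<in> carrier A; z \<in> carrier A; mtl_less A x y; mtl_less A y z\<rbrakk>
    \<Longrightarrow> mtl_less A x z"
  by (metis mtl_less_def le_trans le_antisym)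

lemma join_eq_of_le:
  "\<lbrakk>x \<in> carrier A; y \<in> carrier A; mtl_le A x y\<rbrakk> \<Longrightarrow> ljoin A x y = y"
  by (metis mtl_le_def meet_commute join_commute join_meet_absorb)

lemma imp_eq_one_iff:
  "\<lbrakk>x \<in> carrier A; y \<in> carrier A\<rbrakk> \<Longrightarrow> imp A x y = \<one> \<longleftrightarrow> mtl_le A x y"
  by (metis residuation one_closed r_one one_greatest le_antisym imp_closed le_refl)

text \<open>Residuation at the unit shows that \<open>y\<close> and the residuum have the same lower
  bounds, so each lies below the other.\<close>

lemma imp_one_left:
  assumes "y \<in> carrier A" shows "imp A \<one> y = y"
proof -
  have *: "mtl_le A z y \<longleftrightarrow> mtl_le A z (imp A \<one> y)" if "z \<in> carrier A" for z
    using residuation[of \<one> y z] assms that by simp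
  show ?thesis
    using *[of y] *[of "imp A \<one> y"] assms by (metis imp_closed le_antisym le_refl one_closed)
qed

end

section \<open>Operations of a DP-chain in terms of order, bounds and coatom\<close>

context DP_chain
begin

definition is_coatom :: "'a \<Rightarrow> bool" where
  "is_coatom c \<longleftrightarrow> c \<in> carrier A \<and> c \<noteq> \<one> \<and> (\<forall>x\<in>carrier A. x \<noteq> \<one> \<longrightarrow> mtl_le A x c)"

lemma less_iff_not_le:
  "\<lbrakk>x \<in> carrier A; y \<in> carrier A\<rbrakk> \<Longrightarrow> mtl_less A x y \<longleftrightarrow> \<not> mtl_le A y x"
  by (metis mtl_less_def total le_antisym le_refl)

lemma meet_eq_if:
  "\<lbrakk>x \<in> carrier A; y \<in> carrier A\<rbrakk> \<Longrightarrow> lmeet A x y = (if mtl_le A x y then x else y)"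
  by (metis mtl_le_def total meet_commute)

lemma join_eq_if:
  "\<lbrakk>x \<in> carrier A; y \<in> carrier A\<rbrakk> \<Longrightarrow> ljoin A x y = (if mtl_le A x y then y else x)"
  by (metis join_eq_of_le total join_commute)

lemma mult_eq_if:
  "\<lbrakk>x \<in> carrier A; y \<in> carrier A\<rbrakk>
    \<Longrightarrow> x \<otimes> y = (if x = \<one> then y else if y = \<one> then x else bottom A)"
  by (simp add: drastic_product mtl_less_def one_greatest)
     (metis l_one one_closed one_greatest le_antisym)

text \<open>Every \<open>z\<close> other than the unit has product \<open>0\<close> with
  \<open>x\<close>, so residuation puts \<open>z\<close> below the residuum, which is not the unit
  because \<open>x\<close> is not below \<open>y\<close>.\<close>

lemma imp_is_coatom:
  assumes "x \<in> carrier A" "y \<in> carrier A" "x \<noteq> \<one>" "\<not> mtl_le A x y"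
  shows "is_coatom (imp A x y)"
  unfolding is_coatom_def
proof (intro conjI ballI impI)
  show "imp A x y \<in> carrier A" "imp A x y \<noteq> \<one>"
    using assms imp_closed imp_eq_one_iff by auto
  fix z assume z: "z \<in> carrier A" "z \<noteq> \<one>"
  then have "mtl_le A (x \<otimes> z) y"
    using assms by (simp add: mult_eq_if bottom_least)
  then show "mtl_le A z (imp A x y)"
    using residuation z assms by simp
qed

lemma coatom_unique: "is_coatom c \<Longrightarrow> is_coatom d \<Longrightarrow> c = d"
  unfolding is_coatom_def using le_antisym by blast

text \<open>An element \<open>x\<close> strictly between the bounds yields the coatom as the
  residuum of \<open>x\<close> and \<open>0\<close>; without such an element, \<open>0\<close> is
  the coatom.\<close>

lemma coatom_exists:
  assumes "bottom A \<noteq> \<one>"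
  obtains c where "is_coatom c"
proof (cases "\<exists>x\<in>carrier A. x \<noteq> \<one> \<and> x \<noteq> bottom A")
  case True
  then obtain x where "x \<in> carrier A" "x \<noteq> \<one>" "\<not> mtl_le A x (bottom A)"
    using bottom_least bottom_closed le_antisym by blast
  then show ?thesis
    using imp_is_coatom bottom_closed that by blast
next
  case False
  then have "is_coatom (bottom A)"
    unfolding is_coatom_def using assms bottom_closed le_refl by blast
  then show ?thesis by (rule that)
qed

lemma imp_eq_if:
  assumes "is_coatom c" "x \<in> carrier A" "y \<in> carrier A"
  shows "imp A x y = (if mtl_le A x y then \<one> else if x = \<one> then y else c)"
  using assms imp_eq_one_iff imp_one_left imp_is_coatom coatom_unique by auto

text \<open>Isolates the one-element chain, the only DP-chain without a coatom.\<close>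

lemma carrier_trivial:
  assumes "bottom A = \<one>" "x \<in> carrier A"
  shows "x = \<one>"
  using assms bottom_least one_greatest le_antisym one_closed by metis

end

section \<open>Order isomorphisms between finite subsets of DP-chains\<close>

lemma finite_strict_order_rank:
  fixes R :: "'a \<Rightarrow> 'a \<Rightarrow> bool"
  assumes fin: "finite F"
    and irrefl: "\<And>x. x \<in> F \<Longrightarrow> \<not> R x x"
    and trans: "\<And>x y z. \<lbrakk>x \<in> F; y \<in> F; z \<in> F; R x y; R y z\<rbrakk> \<Longrightarrow> R x z"
    and total: "\<And>x y. \<lbrakk>x \<in> F; y \<in> F; x \<noteq> y\<rbrakk> \<Longrightarrow> R x y \<or> R y x"
  obtains r :: "'a \<Rightarrow> nat" where "bij_betw r F {..<card F}"
    and "\<And>x y. \<lbrakk>x \<in> F; y \<in> F\<rbrakk> \<Longrightarrow> R x y \<longleftrightarrow> r x < r y"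
proof -
  define r where "r x = card {z\<in>F. R z x}" for x
  have mono: "r x < r y" if "x \<in> F" "y \<in> F" "R x y" for x y
  proof -
    have "{z\<in>F. R z x} \<subset> {z\<in>F. R z y}"
      using that irrefl trans by blast
    then show ?thesis
      unfolding r_def using fin by (simp add: psubset_card_mono)
  qed
  have iff: "R x y \<longleftrightarrow> r x < r y" if "x \<in> F" "y \<in> F" for x y
    using that mono total by (metis less_asym less_irrefl)
  have inj: "inj_on r F"
    using iff total by (metis inj_onI less_irrefl)
  \<comment> \<open>No element counts itself, so ranks stay below \<open>card F\<close>; being
    injective, \<open>r\<close> then attains all these values.\<close>
  have "r x < card F" if "x \<in> F" for x
    unfolding r_def using that fin irrefl by (intro psubset_card_mono) auto
  then have "r ` F = {..<card F}"
    using inj by (intro card_subset_eq) (auto simp: card_image)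
  then show ?thesis
    using that inj iff by (auto simp: bij_betw_def)
qed

lemma DP_chain_rank:
  assumes "DP_chain A" "finite F" "F \<subseteq> carrier A"
  obtains r :: "'a \<Rightarrow> nat" where "bij_betw r F {..<card F}"
    and "\<And>x y. \<lbrakk>x \<in> F; y \<in> F\<rbrakk> \<Longrightarrow> mtl_le A x y \<longleftrightarrow> r x \<le> r y"
proof -
  interpret DP_chain A by fact
  have "\<not> mtl_less A x x" for x
    by (simp add: mtl_less_def)
  moreover have "mtl_less A x y \<or> mtl_less A y x" if "x \<in> F" "y \<in> F" "x \<noteq> y" for x y
    using that total assms(3) by (auto simp: mtl_less_def)
  ultimately obtain r :: "'a \<Rightarrow> nat" where "bij_betw r F {..<card F}"
    and "\<And>x y. \<lbrakk>x \<in> F; y \<in> F\<rbrakk> \<Longrightarrow> mtl_less A x y \<longleftrightarrow> r x < r y"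
    using finite_strict_order_rank[of F "mtl_less A"] assms(2,3) less_trans
    by (smt (verit, best) subsetD)
  then show ?thesis
    using that less_iff_not_le assms(3) by (metis linorder_not_less subsetD)
qed

text \<open>Equal cardinality gives both sets the same range of ranks, so the rank on
  \<open>F\<close> can be composed with the inverse of the rank on \<open>T\<close>.\<close>

lemma DP_chain_order_iso:
  assumes "DP_chain B" "finite F" "F \<subseteq> carrier B"
    and "DP_chain A" "finite T" "T \<subseteq> carrier A" "card F = card T"
  obtains h where "bij_betw h F T"
    and "\<And>x y. \<lbrakk>x \<in> F; y \<in> F\<rbrakk> \<Longrightarrow> mtl_le A (h x) (h y) \<longleftrightarrow> mtl_le B x y"
proof -
  obtain r where r: "bij_betw r F {..<card F}"
      "\<And>x y. \<lbrakk>x \<in> F; y \<in> F\<rbrakk> \<Longrightarrow> mtl_le B x y \<longleftrightarrow> r x \<le> r y"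
    using DP_chain_rank assms(1-3) by blast
  obtain s where s: "bij_betw s T {..<card T}"
      "\<And>x y. \<lbrakk>x \<in> T; y \<in> T\<rbrakk> \<Longrightarrow> mtl_le A x y \<longleftrightarrow> s x \<le> s y"
    using DP_chain_rank assms(4-6) by blast
  define h where "h = inv_into T s \<circ> r"
  have h: "bij_betw h F T"
    unfolding h_def using r(1) s(1) assms(7) by (metis bij_betw_inv_into bij_betw_trans)
  have "s (h x) = r x" if "x \<in> F" for x
    using that r(1) s(1) assms(7) unfolding h_def
    by (metis bij_betwE bij_betw_inv_into_right comp_apply)
  then have "mtl_le A (h x) (h y) \<longleftrightarrow> mtl_le B x y" if "x \<in> F" "y \<in> F" for x y
    using that r(2) s(2) h by (metis bij_betwE)
  with h show ?thesis by (rule that)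
qed

lemma exists_subset_of_card_between:
  assumes "finite T0" "T0 \<subseteq> C" "card T0 \<le> n" "infinite C \<or> n \<le> card C"
  obtains T where "T0 \<subseteq> T" "T \<subseteq> C" "finite T" "card T = n"
proof -
  \<comment> \<open>A finite upper set \<open>D\<close> reduces the claim to choosing a set of size
    \<open>n\<close> between \<open>T0\<close> and \<open>D\<close>. If \<open>C\<close> is finite,
    \<open>C\<close> itself serves.\<close>
  obtain D where D: "T0 \<subseteq> D" "D \<subseteq> C" "finite D" "n \<le> card D"
  proof (cases "finite C")
    case True
    then show ?thesis using assms that by blast
  next
    case False
    then obtain D where "D \<subseteq> C" "finite D" "card D = n"
      using infinite_arbitrarily_large by blast
    moreover from this have "n \<le> card (D \<union> T0)"
      using assms(1) by (metis card_mono finite_UnI sup_ge1)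
    ultimately show ?thesis
      using that[of "D \<union> T0"] assms by simp
  qed
  then show ?thesis
    using exists_subset_between[of T0 n D] assms that by (meson finite_subset subset_trans)
qed

section \<open>Terms and the transfer of identities between DP-chains\<close>

primrec vars_of :: "mtl_term \<Rightarrow> nat set" where
  "vars_of (Var i) = {i}"
| "vars_of Bot = {}"
| "vars_of Top = {}"
| "vars_of (Times s t) = vars_of s \<union> vars_of t"
| "vars_of (Imp s t) = vars_of s \<union> vars_of t"
| "vars_of (Meet s t) = vars_of s \<union> vars_of t"
| "vars_of (Join s t) = vars_of s \<union> vars_of t"

lemma finite_vars_of: "finite (vars_of t)"
  by (induction t) auto

lemma (in mtl_algebra) eval_term_closed:
  "(\<And>i. v i \<in> carrier A) \<Longrightarrow> eval_term A v t \<in> carrier A"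
  by (induction t)
     (auto simp: imp_closed meet_closed join_closed bottom_closed)

text \<open>The coatom of \<open>A\<close> has to lie in \<open>T\<close> only if \<open>F\<close> contains some \<open>y < x < 1\<close>; if \<open>B\<close> has two
  elements its coatom is \<open>0\<close>, which need not be mapped to the coatom of \<open>A\<close>.\<close>

lemma DP_chain_partial_embedding_eval:
  assumes B: "DP_chain B" and A: "DP_chain A"
    and cB: "DP_chain.is_coatom B c" and cA: "DP_chain.is_coatom A d"
    and F: "finite F" "F \<subseteq> carrier B" "{bottom B, c, \<one>\<^bsub>B\<^esub>} \<subseteq> F"
    and T: "finite T" "T \<subseteq> carrier A" "{bottom A, \<one>\<^bsub>A\<^esub>} \<subseteq> T" "3 \<le> card F \<Longrightarrow> d \<in> T"
    and card: "card F = card T"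
  obtains h where "inj_on h F" "h ` F \<subseteq> carrier A"
    and "\<And>t v w. \<lbrakk>\<And>i. i \<in> vars_of t \<Longrightarrow> v i \<in> F; \<And>i. i \<in> vars_of t \<Longrightarrow> w i = h (v i)\<rbrakk>
      \<Longrightarrow> eval_term B v t \<in> F \<and> eval_term A w t = h (eval_term B v t)"
proof -
  interpret B: DP_chain B by fact
  interpret A: DP_chain A by fact
  obtain h where h: "bij_betw h F T"
    and le: "\<And>x y. \<lbrakk>x \<in> F; y \<in> F\<rbrakk> \<Longrightarrow> mtl_le A (h x) (h y) \<longleftrightarrow> mtl_le B x y"
    using DP_chain_order_iso[OF B F(1,2) A T(1,2) card] by blast
  have hT: "h x \<in> T" if "x \<in> F" for x
    using that h bij_betwE by blast
  have hA: "h x \<in> carrier A" if "x \<in> F" for x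
    using that hT T(2) by blast
  have inF: "bottom B \<in> F" "c \<in> F" "\<one>\<^bsub>B\<^esub> \<in> F" and inT: "bottom A \<in> T" "\<one>\<^bsub>A\<^esub> \<in> T"
    using F T by auto
  have FB: "x \<in> carrier B" if "x \<in> F" for x
    using that F by blast
  have inj: "inj_on h F"
    using h bij_betw_def by blast
  have surj: "\<exists>x\<in>F. h x = y" if "y \<in> T" for y
    using that h by (metis bij_betw_def imageE)
  \<comment> \<open>The preimage of \<open>bottom A\<close> lies above \<open>bottom B\<close>, so
    monotonicity puts \<open>h (bottom B)\<close> below \<open>bottom A\<close>. The unit is treated
    dually.\<close>
  have h0: "h (bottom B) = bottom A"
  proof -
    obtain x where "x \<in> F" "h x = bottom A" using surj inT by blast
    then show ?thesis
      using le[of "bottom B" x] inF FB B.bottom_least A.bottom_least A.le_antisym hA by metis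
  qed
  have h1: "h \<one>\<^bsub>B\<^esub> = \<one>\<^bsub>A\<^esub>"
  proof -
    obtain x where "x \<in> F" "h x = \<one>\<^bsub>A\<^esub>" using surj inT by blast
    then show ?thesis
      using le[of x "\<one>\<^bsub>B\<^esub>"] inF FB B.one_greatest A.one_greatest A.le_antisym hA by metis
  qed
  have h1_iff: "h x = \<one>\<^bsub>A\<^esub> \<longleftrightarrow> x = \<one>\<^bsub>B\<^esub>" if "x \<in> F" for x
    using that h1 inj inF by (metis inj_onD)
  \<comment> \<open>The preimage of \<open>d\<close> is not the unit, hence lies below
    \<open>c\<close>, which gives \<open>d\<close> below \<open>h c\<close>; conversely
    \<open>h c\<close> is not the unit and so lies below \<open>d\<close>.\<close>
  have hc: "h c = d" if three: "3 \<le> card F"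
  proof -
    obtain x where x: "x \<in> F" "h x = d" using surj T(4)[OF three] by blast
    have "x \<noteq> \<one>\<^bsub>B\<^esub>" using x cA h1 A.is_coatom_def by blast
    then have "mtl_le B x c" using cB x FB B.is_coatom_def by blast
    then have "mtl_le A d (h c)" using le x inF by blast
    moreover have "mtl_le A (h c) d"
      using cA cB h1_iff inF hA unfolding A.is_coatom_def B.is_coatom_def by blast
    ultimately show ?thesis
      using A.le_antisym hA inF x by blast
  qed
  have meet: "lmeet B x y \<in> F \<and> lmeet A (h x) (h y) = h (lmeet B x y)"
    and join: "ljoin B x y \<in> F \<and> ljoin A (h x) (h y) = h (ljoin B x y)"
    and mult: "x \<otimes>\<^bsub>B\<^esub> y \<in> F \<and> h x \<otimes>\<^bsub>A\<^esub> h y = h (x \<otimes>\<^bsub>B\<^esub> y)"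
    and imp: "imp B x y \<in> F \<and> imp A (h x) (h y) = h (imp B x y)"
    if xy: "x \<in> F" "y \<in> F" for x y
  proof -
    show "lmeet B x y \<in> F \<and> lmeet A (h x) (h y) = h (lmeet B x y)"
      using xy FB hA le by (simp add: A.meet_eq_if B.meet_eq_if)
    show "ljoin B x y \<in> F \<and> ljoin A (h x) (h y) = h (ljoin B x y)"
      using xy FB hA le by (simp add: A.join_eq_if B.join_eq_if)
    show "x \<otimes>\<^bsub>B\<^esub> y \<in> F \<and> h x \<otimes>\<^bsub>A\<^esub> h y = h (x \<otimes>\<^bsub>B\<^esub> y)"
      using xy FB hA h1_iff h0 inF by (simp add: A.mult_eq_if B.mult_eq_if)
    \<comment> \<open>This is the only case where the residuum is computed as the coatom; it
      supplies the three elements that \<open>hc\<close> requires.\<close>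
    have "3 \<le> card F" if "\<not> mtl_le B x y" "x \<noteq> \<one>\<^bsub>B\<^esub>"
    proof -
      have "y \<noteq> \<one>\<^bsub>B\<^esub>" "x \<noteq> y"
        using that xy FB B.one_greatest B.le_refl by auto
      then have "card {x, y, \<one>\<^bsub>B\<^esub>} = 3" using that by simp
      then show ?thesis
        using card_mono[of F "{x, y, \<one>\<^bsub>B\<^esub>}"] F(1) xy inF by simp
    qed
    then show "imp B x y \<in> F \<and> imp A (h x) (h y) = h (imp B x y)"
      using xy FB hA h1_iff le inF hc
      by (simp add: h1 A.imp_eq_if[OF cA] B.imp_eq_if[OF cB])
  qed
  have "eval_term B v t \<in> F \<and> eval_term A w t = h (eval_term B v t)"
    if "\<And>i. i \<in> vars_of t \<Longrightarrow> v i \<in> F" "\<And>i. i \<in> vars_of t \<Longrightarrow> w i = h (v i)" for t v w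
    using that by (induction t) (simp_all add: inF h0 h1 meet join mult imp)
  then show ?thesis
    using that inj hA by blast
qed

text \<open>The summand \<open>3\<close> makes room for \<open>0\<close>, the coatom and
  \<open>1\<close> beside the values of the variables.\<close>

lemma DP_chain_satisfies_transfer:
  assumes A: "DP_chain A" and B: "DP_chain B"
    and sat: "satisfies A e"
    and large: "infinite (carrier A) \<or> card (vars_of (fst e) \<union> vars_of (snd e)) + 3 < card (carrier A)"
  shows "satisfies B e"
proof -
  interpret A: DP_chain A by fact
  interpret B: DP_chain B by fact
  define V where "V = vars_of (fst e) \<union> vars_of (snd e)"
  have finV: "finite V" by (simp add: V_def finite_vars_of)
  \<comment> \<open>The size bound excludes the one-element chain, so \<open>A\<close> has a
    coatom.\<close>
  have "bottom A \<noteq> \<one>\<^bsub>A\<^esub>"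
  proof
    assume "bottom A = \<one>\<^bsub>A\<^esub>"
    then have *: "carrier A \<subseteq> {\<one>\<^bsub>A\<^esub>}" using A.carrier_trivial by blast
    then show False using large card_mono[OF _ *] finite_subset[OF *] by auto
  qed
  then obtain d where d: "A.is_coatom d" using A.coatom_exists by blast
  have eq: "eval_term B v (fst e) = eval_term B v (snd e)" if v: "\<And>i. v i \<in> carrier B" for v
  proof (cases "bottom B = \<one>\<^bsub>B\<^esub>")
    case True
    then show ?thesis using B.carrier_trivial B.eval_term_closed v by metis
  next
    case False
    then obtain c where c: "B.is_coatom c" using B.coatom_exists by blast
    define F where "F = v ` V \<union> {bottom B, c, \<one>\<^bsub>B\<^esub>}"
    have F: "finite F" "F \<subseteq> carrier B" "{bottom B, c, \<one>\<^bsub>B\<^esub>} \<subseteq> F"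
      using v c finV B.bottom_closed B.is_coatom_def by (auto simp: F_def)
    have "card F \<le> card (v ` V) + card {bottom B, c, \<one>\<^bsub>B\<^esub>}"
      unfolding F_def by (rule card_Un_le)
    also have "\<dots> \<le> card V + 3"
      using card_image_le[OF finV, of v] by (intro add_mono) (auto simp: card_insert_if)
    finally have cardF: "infinite (carrier A) \<or> card F \<le> card (carrier A)"
      using large unfolding V_def by linarith
    have "card {bottom B, \<one>\<^bsub>B\<^esub>} \<le> card F"
      using F by (intro card_mono) auto
    then have two: "2 \<le> card F" using False by simp
    \<comment> \<open>When \<open>F\<close> has only two elements, also requiring \<open>d\<close>
      could make \<open>T0\<close> larger than \<open>F\<close>.\<close>
    define T0 where "T0 = (if 3 \<le> card F then {bottom A, d, \<one>\<^bsub>A\<^esub>} else {bottom A, \<one>\<^bsub>A\<^esub>})"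
    have "finite T0" "T0 \<subseteq> carrier A" "card T0 \<le> card F"
      using d two A.bottom_closed A.is_coatom_def by (auto simp: T0_def card_insert_if)
    then obtain T where T: "T0 \<subseteq> T" "T \<subseteq> carrier A" "finite T" "card T = card F"
      using exists_subset_of_card_between cardF by metis
    have T': "{bottom A, \<one>\<^bsub>A\<^esub>} \<subseteq> T" "3 \<le> card F \<Longrightarrow> d \<in> T"
      using T(1) by (auto simp: T0_def split: if_splits)
    obtain h where h: "inj_on h F" "h ` F \<subseteq> carrier A"
      and ev: "\<And>t v w. \<lbrakk>\<And>i. i \<in> vars_of t \<Longrightarrow> v i \<in> F; \<And>i. i \<in> vars_of t \<Longrightarrow> w i = h (v i)\<rbrakk>
        \<Longrightarrow> eval_term B v t \<in> F \<and> eval_term A w t = h (eval_term B v t)"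
      using DP_chain_partial_embedding_eval[OF B A c d F T(3,2) T' T(4)[symmetric]] by blast
    \<comment> \<open>Off \<open>V\<close> the value \<open>v i\<close> may lie outside
      \<open>F\<close>, where \<open>h\<close> is uncontrolled; the default keeps \<open>w\<close>
      in the carrier.\<close>
    define w where "w i = (if i \<in> V then h (v i) else bottom A)" for i
    have "w i \<in> carrier A" for i
      using h(2) A.bottom_closed by (auto simp: w_def F_def)
    then have "eval_term A w (fst e) = eval_term A w (snd e)"
      using sat by (simp add: satisfies_def)
    moreover have "eval_term B v t \<in> F \<and> eval_term A w t = h (eval_term B v t)"
      if "vars_of t \<subseteq> V" for t
      using that by (intro ev) (auto simp: F_def w_def)
    \<comment> \<open>Both sides of the identity evaluate in \<open>B\<close> to elements of
      \<open>F\<close> with the same image, and \<open>h\<close> is injective there.\<close>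
    ultimately show ?thesis
      using h(1) by (metis V_def Un_upper1 Un_upper2 inj_onD)
  qed
  then show ?thesis by (simp add: satisfies_def)
qed

section \<open>Finite DP-chains of every size\<close>

text \<open>For injective \<open>f\<close>, the chain on the indices \<open>0\<close> to
  \<open>n\<close> is transported along \<open>f\<close>. The index \<open>n - 1\<close> is that of
  the coatom; for \<open>n = 0\<close> this branch is never reached on the carrier.\<close>

definition finite_DP_chain :: "(nat \<Rightarrow> 'u) \<Rightarrow> nat \<Rightarrow> 'u mtl" where
  "finite_DP_chain f n = \<lparr>carrier = f ` {..n},
    mult = (\<lambda>x y. f (if the_inv f x < n \<and> the_inv f y < n then 0 else min (the_inv f x) (the_inv f y))),
    one = f n,
    imp = (\<lambda>x y. f (if the_inv f x \<le> the_inv f y then n else if the_inv f x = n then the_inv f y else n - 1)),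
    lmeet = (\<lambda>x y. f (min (the_inv f x) (the_inv f y))),
    ljoin = (\<lambda>x y. f (max (the_inv f x) (the_inv f y))),
    bottom = f 0\<rparr>"

lemma finite_DP_chain_sel:
  "carrier (finite_DP_chain f n) = f ` {..n}"
  "mult (finite_DP_chain f n) x y =
    f (if the_inv f x < n \<and> the_inv f y < n then 0 else min (the_inv f x) (the_inv f y))"
  "one (finite_DP_chain f n) = f n"
  "imp (finite_DP_chain f n) x y =
    f (if the_inv f x \<le> the_inv f y then n else if the_inv f x = n then the_inv f y else n - 1)"
  "lmeet (finite_DP_chain f n) x y = f (min (the_inv f x) (the_inv f y))"
  "ljoin (finite_DP_chain f n) x y = f (max (the_inv f x) (the_inv f y))"
  "bottom (finite_DP_chain f n) = f 0"
  by (simp_all add: finite_DP_chain_def)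

lemma DP_chain_finite_DP_chain:
  assumes "inj f"
  shows "DP_chain (finite_DP_chain f n)"
proof -
  have [simp]: "f i = f j \<longleftrightarrow> i = j" for i j
    using assms by (simp add: inj_eq)
  have [simp]: "the_inv f (f i) = i" for i
    using assms by (rule the_inv_f_f)
  have le: "mtl_le (finite_DP_chain f n) (f i) (f j) \<longleftrightarrow> i \<le> j" for i j
    by (auto simp: mtl_le_def finite_DP_chain_def)
  have less: "mtl_less (finite_DP_chain f n) (f i) (f j) \<longleftrightarrow> i < j" for i j
    by (auto simp: mtl_less_def le)
  show ?thesis
    by unfold_locales (auto simp: finite_DP_chain_sel le less min_def max_def)
qed

lemma card_carrier_finite_DP_chain:
  "inj f \<Longrightarrow> card (carrier (finite_DP_chain f n)) = Suc n"
  by (simp add: finite_DP_chain_def card_image inj_on_subset)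

section \<open>Generated varieties and their identities\<close>

text \<open>The identities valid throughout \<open>K\<close> form the largest \<open>E\<close> with
  \<open>K \<subseteq> variety E\<close>, so the intersection is attained at this
  \<open>E\<close>.\<close>

lemma mem_generated_variety_iff:
  assumes "\<And>A. A \<in> K \<Longrightarrow> mtl_algebra A"
  shows "M \<in> generated_variety K \<longleftrightarrow>
    mtl_algebra M \<and> (\<forall>e. (\<forall>A\<in>K. satisfies A e) \<longrightarrow> satisfies M e)"
proof
  assume M: "M \<in> generated_variety K"
  have "K \<subseteq> variety {e. \<forall>A\<in>K. satisfies A e}"
    using assms by (auto simp: variety_def)
  then have "M \<in> variety {e. \<forall>A\<in>K. satisfies A e}"
    using M unfolding generated_variety_def by blast
  then show "mtl_algebra M \<and> (\<forall>e. (\<forall>A\<in>K. satisfies A e) \<longrightarrow> satisfies M e)"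
    by (simp add: variety_def)
qed (auto simp: generated_variety_def variety_def)

text \<open>An identity has finitely many variables, so some member of \<open>S\<close> is large
  enough for the transfer to \<open>B\<close>.\<close>

lemma satisfies_all_DP_chains:
  assumes "\<And>A. A \<in> S \<Longrightarrow> DP_chain A"
    and "\<And>n::nat. \<exists>A\<in>S. infinite (carrier A) \<or> n < card (carrier A)"
    and "\<forall>A\<in>S. satisfies A e" "DP_chain B"
  shows "satisfies B e"
  using assms DP_chain_satisfies_transfer by metis

theorem theorem9:
  fixes S :: "'a mtl set"
  assumes "\<And>A. A \<in> S \<Longrightarrow> DP_chain A"
    and "\<And>n::nat. \<exists>A\<in>S. infinite (carrier A) \<or> n < card (carrier A)"
  shows "(generated_variety S :: 'c mtl set) = DP TYPE('u::infinite)"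
proof -
  let ?U = "Collect DP_chain :: 'u mtl set"
  \<comment> \<open>A copy of the natural numbers in \<open>'u\<close> carries finite DP-chains, so
    \<open>?U\<close> is unbounded too: indices up to \<open>n\<close> give \<open>n + 1\<close>
    elements.\<close>
  obtain f :: "nat \<Rightarrow> 'u" where f: "inj f"
    using infinite_UNIV infinite_countable_subset by blast
  have U: "\<exists>A\<in>?U. infinite (carrier A) \<or> n < card (carrier A)" for n
    using DP_chain_finite_DP_chain[OF f, of n] card_carrier_finite_DP_chain[OF f, of n] by auto
  \<comment> \<open>Both families are unbounded and consist of DP-chains, so the transfer applies in
    either direction, even across different carrier types.\<close>
  have "(\<forall>A\<in>S. satisfies A e) \<longleftrightarrow> (\<forall>A\<in>?U. satisfies A e)" for e
    using satisfies_all_DP_chains[of S e] satisfies_all_DP_chains[of ?U e] assms U by blast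
  moreover have "mtl_algebra A" if "A \<in> S" for A
    using assms(1) that by (simp add: DP_chain.axioms(1))
  moreover have "mtl_algebra A" if "A \<in> ?U" for A
    using that by (simp add: DP_chain.axioms(1))
  ultimately show ?thesis
    unfolding DP_def set_eq_iff by (simp only: mem_generated_variety_iff simp_thms)
qed

end
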